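(* Let $(P,\le,* )$ be a relatively pseudocomplemented poset satisfying the Ascending Chain Condition, let $T(x,y,z):=\operatorname{Max}L\big((x*y)*z,(z*y)*x\big)$ for $x,y,z\in P$, and let $\Theta$ be a reflexive binary relation on $P$ which is compatible with the binary operators $\operatorname{Max}L$, $\operatorname{Min}U$ and with $*$. Then $\Theta$ is a congruence on $(P,\le,* )$.
   Context: For a poset $(P,\le)$ and $x,y\in P$ let $L(x,y)=\{z\in P\mid z\le x,\ z\le y\}$ and $U(x,y)=\{z\in P\mid x\le z,\ y\le z\}$; $\operatorname{Max}A$ and $\operatorname{Min}A$ denote the sets of maximal and minimal elements of $A\subseteq P$. A poset is relatively pseudocomplemented if for all $x,y\in P$ there exists a greatest element $z$ of $P$ such that every element of $L(x,z)$ is $\le y$; this $z$ is denoted $x*y$. A binary relation $R$ on $P$ is compatible with a map $Q\colon P^2\to 2^P$ if whenever $(a_1,b_1),(a_2,b_2)\in R$ there exist $a\in Q(a_1,a_2)$ and $b\in Q(b_1,b_2)$ with $(a,b)\in R$; it is compatible with the operation $*$ if $(a_1,b_1),(a_2,b_2)\in R$ imply $(a_1*a_2,b_1*b_2)\in R$. A congruence on $(P,\le,* )$ is an equivalence relation on $P$ compatible with $(x,y)\mapsto\operatorname{Max}L(x,y)$, $(x,y)\mapsto\operatorname{Min}U(x,y)$ and $*$. *)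

theory Defs
  imports Main
begin

definition L :: "'a::order \<Rightarrow> 'a \<Rightarrow> 'a set" where
  "L x y = {z. z \<le> x \<and> z \<le> y}"

definition U :: "'a::order \<Rightarrow> 'a \<Rightarrow> 'a set" where
  "U x y = {z. x \<le> z \<and> y \<le> z}"

text \<open>The sets of maximal and minimal elements, as opposed to the library's
  \<^const>\<open>Max\<close> and \<^const>\<open>Min\<close>, which return a single element.\<close>

definition Maxl :: "'a::order set \<Rightarrow> 'a set" where
  "Maxl A = {x \<in> A. \<not> (\<exists>y\<in>A. x < y)}"

definition Minl :: "'a::order set \<Rightarrow> 'a set" where
  "Minl A = {x \<in> A. \<not> (\<exists>y\<in>A. y < x)}"

definition is_greatest :: "'a::order \<Rightarrow> 'a set \<Rightarrow> bool" where
  "is_greatest z A \<longleftrightarrow> z \<in> A \<and> (\<forall>w\<in>A. w \<le> z)"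

text \<open>Greatest elements are unique, so an operation satisfying this predicate exists
  iff the poset is relatively pseudocomplemented, and it is then the operation of
  relative pseudocomplementation.\<close>

definition rel_pseudocomplemented :: "('a::order \<Rightarrow> 'a \<Rightarrow> 'a) \<Rightarrow> bool" where
  "rel_pseudocomplemented star \<longleftrightarrow>
     (\<forall>x y. is_greatest (star x y) {z. \<forall>w \<in> L x z. w \<le> y})"

text \<open>The type argument stands for the poset; there is no infinite strictly ascending chain.\<close>

definition ACC :: "'a::order itself \<Rightarrow> bool" where
  "ACC _ \<longleftrightarrow> \<not> (\<exists>f :: nat \<Rightarrow> 'a. \<forall>n. f n < f (Suc n))"

definition compatible_set_op :: "('a \<Rightarrow> 'a \<Rightarrow> 'a set) \<Rightarrow> 'a rel \<Rightarrow> bool" where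
  "compatible_set_op Q R \<longleftrightarrow>
     (\<forall>a1 b1 a2 b2. (a1, b1) \<in> R \<longrightarrow> (a2, b2) \<in> R \<longrightarrow>
        (\<exists>a \<in> Q a1 a2. \<exists>b \<in> Q b1 b2. (a, b) \<in> R))"

definition compatible_op :: "('a \<Rightarrow> 'a \<Rightarrow> 'a) \<Rightarrow> 'a rel \<Rightarrow> bool" where
  "compatible_op g R \<longleftrightarrow>
     (\<forall>a1 b1 a2 b2. (a1, b1) \<in> R \<longrightarrow> (a2, b2) \<in> R \<longrightarrow> (g a1 a2, g b1 b2) \<in> R)"

definition congruence :: "('a::order \<Rightarrow> 'a \<Rightarrow> 'a) \<Rightarrow> 'a rel \<Rightarrow> bool" where
  "congruence star R \<longleftrightarrow>
     equiv UNIV R \<and>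
     compatible_set_op (\<lambda>x y. Maxl (L x y)) R \<and>
     compatible_set_op (\<lambda>x y. Minl (U x y)) R \<and>
     compatible_op star R"

end

theory Submission
  imports Defs
begin

text \<open>
  The operator \<open>T\<close> is a set-valued Mal'cev term: \<open>T x x z = {z}\<close> and \<open>T x z z = {x}\<close>, because
  \<open>x * x\<close> is the top element, \<open>1 * z = z\<close> and \<open>z \<le> (z * x) * x\<close>. As \<open>\<Theta>\<close> is compatible with
  \<open>T\<close>, symmetry and transitivity follow from reflexivity as in Mal'cev varieties.
\<close>

text \<open>The set whose greatest element is \<open>star x y\<close> is closed downwards, so lying
  below \<open>star x y\<close> is the same as belonging to it.\<close>

lemma star_ge_iff:
  assumes "rel_pseudocomplemented star"
  shows "z \<le> star x y \<longleftrightarrow> (\<forall>w. w \<le> x \<longrightarrow> w \<le> z \<longrightarrow> w \<le> y)"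
proof -
  have "\<forall>w\<in>L x (star x y). w \<le> y" and "(\<forall>w\<in>L x z. w \<le> y) \<Longrightarrow> z \<le> star x y"
    using assms by (auto simp: rel_pseudocomplemented_def is_greatest_def)
  then show ?thesis
    unfolding L_def by (blast intro: order_trans)
qed

lemma le_star_self:
  assumes "rel_pseudocomplemented star"
  shows "z \<le> star x x"
  by (simp add: star_ge_iff[OF assms])

lemma star_self_star:
  assumes "rel_pseudocomplemented star"
  shows "star (star x x) z = z"
proof (rule antisym)
  show "star (star x x) z \<le> z"
    \<comment> \<open>The witness \<open>w\<close> is \<open>star (star x x) z\<close> itself, which
      lies below the top element \<open>star x x\<close>.\<close>
    using star_ge_iff[OF assms, of "star (star x x) z" "star x x" z] le_star_self[OF assms] by blast
  show "z \<le> star (star x x) z"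
    by (simp add: star_ge_iff[OF assms])
qed

text \<open>Modus ponens: whatever lies below both \<open>z\<close> and \<open>star z x\<close> lies
  below \<open>x\<close>.\<close>

lemma le_star_star:
  assumes "rel_pseudocomplemented star"
  shows "z \<le> star (star z x) x"
  using star_ge_iff[OF assms] by blast

lemma Maxl_L_absorb1: "x \<le> y \<Longrightarrow> Maxl (L x y) = {x}"
  by (auto simp: Maxl_def L_def less_le_not_le dest: order.antisym)

lemma L_commute: "L x y = L y x"
  by (auto simp: L_def)

lemma Maltsev_operator:
  assumes "rel_pseudocomplemented star"
  shows "Maxl (L (star (star x x) z) (star (star z x) x)) = {z}"
    and "Maxl (L (star (star x z) z) (star (star z z) x)) = {x}"
  \<comment> \<open>In the second equation the smaller argument \<open>x\<close> of \<open>L\<close>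
    comes second, so it is swapped to the front for \<open>Maxl_L_absorb1\<close>.\<close>
  by (simp_all add: star_self_star[OF assms] le_star_star[OF assms] Maxl_L_absorb1
      L_commute[of "star (star x z) z"])

theorem theorem4p6:
  fixes star :: "'a::order \<Rightarrow> 'a \<Rightarrow> 'a"
    and T :: "'a \<Rightarrow> 'a \<Rightarrow> 'a \<Rightarrow> 'a set"
    and \<Theta> :: "'a rel"
  assumes "rel_pseudocomplemented star"
    and "ACC TYPE('a)"
    and "\<And>x y z. T x y z = Maxl (L (star (star x y) z) (star (star z y) x))"
    and "refl \<Theta>"
    and "compatible_set_op (\<lambda>x y. Maxl (L x y)) \<Theta>"
    and "compatible_set_op (\<lambda>x y. Minl (U x y)) \<Theta>"
    and "compatible_op star \<Theta>"
  shows "congruence star \<Theta>"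
proof -
  have T_left: "T x x z = {z}" and T_right: "T x z z = {x}" for x z
    using Maltsev_operator[OF assms(1)] by (simp_all add: assms(3))
  have refl: "(x, x) \<in> \<Theta>" for x
    using assms(4) by (simp add: reflD)
  have star: "(star a1 a2, star b1 b2) \<in> \<Theta>" if "(a1, b1) \<in> \<Theta>" "(a2, b2) \<in> \<Theta>" for a1 b1 a2 b2
    using assms(7) that by (simp add: compatible_op_def)
  have T: "\<exists>a\<in>T a1 a2 a3. \<exists>b\<in>T b1 b2 b3. (a, b) \<in> \<Theta>"
    if "(a1, b1) \<in> \<Theta>" "(a2, b2) \<in> \<Theta>" "(a3, b3) \<in> \<Theta>" for a1 b1 a2 b2 a3 b3
  proof -
    have "(star (star a1 a2) a3, star (star b1 b2) b3) \<in> \<Theta>"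
      and "(star (star a3 a2) a1, star (star b3 b2) b1) \<in> \<Theta>"
      using that by (simp_all add: star)
    then show ?thesis
      using assms(5) by (simp add: compatible_set_op_def assms(3))
  qed
  have "sym \<Theta>"
  proof (rule symI)
    fix x y assume "(x, y) \<in> \<Theta>"
    \<comment> \<open>The left components give \<open>T x x y = {y}\<close>, the right ones
      \<open>T x y y = {x}\<close>.\<close>
    from T[OF refl[of x] this refl[of y]] show "(y, x) \<in> \<Theta>"
      by (simp add: T_left T_right)
  qed
  moreover have "trans \<Theta>"
  proof (rule transI)
    fix x y z assume "(x, y) \<in> \<Theta>" "(y, z) \<in> \<Theta>"
    \<comment> \<open>Here the singletons are \<open>T x y y = {x}\<close> and
      \<open>T y y z = {z}\<close>.\<close>
    from T[OF this(1) refl[of y] this(2)] show "(x, z) \<in> \<Theta>"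
      by (simp add: T_left T_right)
  qed
  ultimately have "equiv UNIV \<Theta>"
    using assms(4) by (simp add: equiv_def)
  then show ?thesis
    using assms(5-7) by (simp add: congruence_def)
qed

end
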